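(* If $P$ is a finite twin-free, rank-connected planar lattice, then $D(P)\le 2$.
   Context: A poset with a unique minimum $\hat0$ and unique maximum $\hat1$ is ranked if every maximal chain from $\hat0$ to $\hat1$ has the same length (a chain with $r$ points has length $r-1$); the rank of a point $x$ is the length of a longest chain having $x$ as its largest element. A ranked poset is rank-connected if for every pair of consecutive ranks, the subgraph of the Hasse diagram induced by the points of those two ranks is connected. A poset is planar if its Hasse diagram can be drawn in the plane with no crossing edges and with each edge from $a$ to $b$, $a\prec b$, having strictly increasing $y$-coordinate. Incomparable points $x,y$ are twins if they have the same relationship to every other point (for every $z\ne x,y$: $z\prec x\iff z\prec y$ and $x\prec z\iff y\prec z$); a poset is twin-free if it has no twins. A coloring is distinguishing if the only color-preserving automorphism is the identity; $D(P)$ is the least number of colors in a distinguishing coloring of $P$. *)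

theory Defs
  imports "HOL-Analysis.Analysis"
begin

text \<open>A poset is a type of class \<open>order\<close>; notions that concern the poset as a whole take an argument
  of type \<open>'a itself\<close>.\<close>

definition covered_by :: "'a::order \<Rightarrow> 'a \<Rightarrow> bool"
  where "covered_by a b \<longleftrightarrow> a < b \<and> (\<nexists>c. a < c \<and> c < b)"

definition chain_length :: "'a set \<Rightarrow> nat"
  where "chain_length C = card C - 1"

definition ranked :: "'a::{finite,order} itself \<Rightarrow> bool"
  where "ranked _ \<longleftrightarrow>
    (\<exists>bt tp :: 'a. (\<forall>x. bt \<le> x) \<and> (\<forall>x. x \<le> tp) \<and>
      (\<forall>C D. pred_on.maxchain UNIV (<) C \<and> bt \<in> C \<and> tp \<in> C \<and>
             pred_on.maxchain UNIV (<) D \<and> bt \<in> D \<and> tp \<in> D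
             \<longrightarrow> chain_length C = chain_length D))"

definition poset_rank :: "'a::{finite,order} \<Rightarrow> nat"
  where "poset_rank x = Max {chain_length C | C.
    pred_on.chain UNIV (<) C \<and> x \<in> C \<and> (\<forall>y\<in>C. y \<le> x)}"

definition hasse_edges_on :: "'a::order set \<Rightarrow> 'a rel"
  where "hasse_edges_on V = {(a, b). a \<in> V \<and> b \<in> V \<and> (covered_by a b \<or> covered_by b a)}"

definition hasse_connected_on :: "'a::order set \<Rightarrow> bool"
  where "hasse_connected_on V \<longleftrightarrow> (\<forall>x\<in>V. \<forall>y\<in>V. (x, y) \<in> (hasse_edges_on V)\<^sup>*)"

definition rank_connected :: "'a::{finite,order} itself \<Rightarrow> bool"
  where "rank_connected _ \<longleftrightarrow> ranked TYPE('a) \<and>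
    (\<forall>i. (\<exists>x::'a. poset_rank x = i) \<and> (\<exists>x::'a. poset_rank x = Suc i)
      \<longrightarrow> hasse_connected_on {x::'a. poset_rank x = i \<or> poset_rank x = Suc i})"

text \<open>The point \<open>x\<close> is drawn at \<open>pos x\<close>, the edge from \<open>a\<close> up to \<open>b\<close> as the curve \<open>\<gamma> a b\<close> (only
  relevant if \<open>b\<close> covers \<open>a\<close>). Distinct edges may meet only in the position of a common
  endpoint, and an edge contains the position of no point except its endpoints.\<close>

definition planar_drawing ::
    "('a::order \<Rightarrow> real \<times> real) \<Rightarrow> ('a \<Rightarrow> 'a \<Rightarrow> real \<Rightarrow> real \<times> real) \<Rightarrow> bool"
  where "planar_drawing pos \<gamma> \<longleftrightarrow>
    inj pos \<and>
    (\<forall>a b. covered_by a b \<longrightarrow>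
       path (\<gamma> a b) \<and> pathstart (\<gamma> a b) = pos a \<and> pathfinish (\<gamma> a b) = pos b \<and>
       strict_mono_on {0..1} (\<lambda>t. snd (\<gamma> a b t))) \<and>
    (\<forall>a b c d. covered_by a b \<and> covered_by c d \<and> (a, b) \<noteq> (c, d) \<longrightarrow>
       path_image (\<gamma> a b) \<inter> path_image (\<gamma> c d) \<subseteq> pos ` ({a, b} \<inter> {c, d})) \<and>
    (\<forall>a b v. covered_by a b \<and> pos v \<in> path_image (\<gamma> a b) \<longrightarrow> v = a \<or> v = b)"

definition planar_poset :: "'a::order itself \<Rightarrow> bool"
  where "planar_poset _ \<longleftrightarrow>
    (\<exists>(pos :: 'a \<Rightarrow> real \<times> real) \<gamma>. planar_drawing pos \<gamma>)"

definition twins :: "'a::order \<Rightarrow> 'a \<Rightarrow> bool"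
  where "twins x y \<longleftrightarrow> \<not> x \<le> y \<and> \<not> y \<le> x \<and>
    (\<forall>z. z \<noteq> x \<and> z \<noteq> y \<longrightarrow> (z < x \<longleftrightarrow> z < y) \<and> (x < z \<longleftrightarrow> y < z))"

definition twin_free :: "'a::order itself \<Rightarrow> bool"
  where "twin_free _ \<longleftrightarrow> (\<nexists>x y :: 'a. twins x y)"

definition order_automorphism :: "('a::order \<Rightarrow> 'a) \<Rightarrow> bool"
  where "order_automorphism f \<longleftrightarrow> bij f \<and> (\<forall>x y. x \<le> y \<longleftrightarrow> f x \<le> f y)"

definition distinguishing :: "('a::order \<Rightarrow> 'c) \<Rightarrow> bool"
  where "distinguishing c \<longleftrightarrow>
    (\<forall>f. order_automorphism f \<and> (\<forall>x. c (f x) = c x) \<longrightarrow> f = id)"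

definition distinguishing_number :: "'a::{finite,order} itself \<Rightarrow> nat"
  where "distinguishing_number _ =
    (LEAST k. \<exists>c :: 'a \<Rightarrow> nat. distinguishing c \<and> card (range c) = k)"

end

theory Submission imports Defs begin

text \<open>In a planar drawing every saturated chain from bottom to top is a curve that is a graph over the
  vertical axis, and two such curves meet only in vertices (or edges) common to both chains, which
  have the same rank in both. Being to the left of such a curve therefore orders every level
  linearly, and the edges between consecutive levels do not cross with respect to these orders. If
  this bipartite graph is connected, it is a caterpillar, and an automorphism that fixes the leftmost
  vertex of both levels can only permute leaves with a common neighbour. Colour the leftmost vertex
  of each level with one colour and everything else with another. If a colour-preserving
  automorphism moves \<open>x\<close>, then \<open>x\<close> and its image have the same lower and the same upper covers, so
  they are twins.\<close>

section \<open>Ranks and saturated chains\<close>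

lemma covered_by_less: "covered_by a b \<Longrightarrow> a < b"
  by (simp add: covered_by_def)

lemma exists_upper_cover:
  fixes x z :: "'a::{finite,order}"
  assumes "x < z"
  obtains u where "covered_by x u" "u \<le> z"
proof -
  have "finite {y. x < y \<and> y \<le> z}" "{y. x < y \<and> y \<le> z} \<noteq> {}"
    using assms by auto
  then obtain u where "u \<in> {y. x < y \<and> y \<le> z}"
    and "\<forall>y\<in>{y. x < y \<and> y \<le> z}. y \<le> u \<longrightarrow> u = y"
    using finite_has_minimal[of "{y. x < y \<and> y \<le> z}"] by metis
  then have "covered_by x u" "u \<le> z"
    unfolding covered_by_def by (auto dest: order.strict_implies_order order.strict_trans1)
  then show thesis by (rule that)
qed

lemma exists_lower_cover:
  fixes x z :: "'a::{finite,order}"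
  assumes "z < x"
  obtains u where "covered_by u x" "z \<le> u"
proof -
  have "finite {y. z \<le> y \<and> y < x}" "{y. z \<le> y \<and> y < x} \<noteq> {}"
    using assms by auto
  then obtain u where "u \<in> {y. z \<le> y \<and> y < x}"
    and "\<forall>y\<in>{y. z \<le> y \<and> y < x}. u \<le> y \<longrightarrow> u = y"
    using finite_has_maximal[of "{y. z \<le> y \<and> y < x}"] by metis
  then have "covered_by u x" "z \<le> u"
    unfolding covered_by_def by (auto, metis less_le_not_le order.trans)
  then show thesis by (rule that)
qed

lemma chain_iff:
  "pred_on.chain UNIV (<) C \<longleftrightarrow> (\<forall>x\<in>C. \<forall>y\<in>C. x \<le> y \<or> y \<le> (x::'a::order))"
  unfolding pred_on.chain_def by (auto simp: le_less)

definition chain_below :: "'a::order \<Rightarrow> 'a set \<Rightarrow> bool"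
  where "chain_below x C \<longleftrightarrow> pred_on.chain UNIV (<) C \<and> x \<in> C \<and> (\<forall>y\<in>C. y \<le> x)"

text \<open>Inclusion-maximal among the chains whose lengths \<open>poset_rank\<close>
  maximizes.\<close>

definition saturated_below :: "'a::order \<Rightarrow> 'a set \<Rightarrow> bool"
  where "saturated_below x C \<longleftrightarrow> chain_below x C \<and> (\<forall>D. chain_below x D \<and> C \<subseteq> D \<longrightarrow> D = C)"

definition chain_above :: "'a::order \<Rightarrow> 'a set \<Rightarrow> bool"
  where "chain_above x C \<longleftrightarrow> pred_on.chain UNIV (<) C \<and> x \<in> C \<and> (\<forall>y\<in>C. x \<le> y)"

locale graded_poset =
  fixes bt tp :: "'a::{finite,order}"
  assumes bt_le: "bt \<le> x" and le_tp: "x \<le> tp"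
    and maxchain_length: "\<lbrakk>pred_on.maxchain UNIV (<) C; bt \<in> C; tp \<in> C;
      pred_on.maxchain UNIV (<) D; bt \<in> D; tp \<in> D\<rbrakk> \<Longrightarrow> chain_length C = chain_length D"
begin

text \<open>Completing both chains by one and the same maximal chain above \<open>x\<close> gives
  two maximal chains from \<open>bt\<close> to \<open>tp\<close>, which have equal length.\<close>

lemma saturated_below_card:
  fixes x :: 'a
  assumes C: "saturated_below x C" and D: "saturated_below x D"
  shows "card C = card D"
proof -
  have "finite (Collect (chain_above x))" by simp
  moreover have "chain_above x {x}"
    by (auto simp: chain_above_def chain_iff)
  ultimately obtain U where U: "chain_above x U" and Umax: "\<And>V. chain_above x V \<Longrightarrow> U \<subseteq> V \<Longrightarrow> V = U"
    using finite_has_maximal[of "Collect (chain_above x)"] by blast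
  have mx: "pred_on.maxchain UNIV (<) (E \<union> U)" "bt \<in> E \<union> U" "tp \<in> E \<union> U"
    "card (E \<union> U) + 1 = card E + card U" if E: "saturated_below x E" for E
  proof -
    have E1: "chain_below x E" and Emax: "\<And>V. chain_below x V \<Longrightarrow> E \<subseteq> V \<Longrightarrow> V = E"
      using E by (auto simp: saturated_below_def)
    have ch: "pred_on.chain UNIV (<) (E \<union> U)"
      using E1 U by (auto simp: chain_iff chain_below_def chain_above_def intro: order.trans)
    have max: "F = E \<union> U" if F: "pred_on.chain UNIV (<) F" "E \<union> U \<subseteq> F" for F
    proof -
      have x: "x \<in> F" using F E1 by (auto simp: chain_below_def)
      have "chain_below x {y\<in>F. y \<le> x}"
        using F x by (auto simp: chain_below_def chain_iff)
      moreover have "E \<subseteq> {y\<in>F. y \<le> x}" using F E1 by (auto simp: chain_below_def)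
      ultimately have 1: "{y\<in>F. y \<le> x} = E" by (rule Emax)
      have "chain_above x {y\<in>F. x \<le> y}"
        using F x by (auto simp: chain_above_def chain_iff)
      moreover have "U \<subseteq> {y\<in>F. x \<le> y}" using F U by (auto simp: chain_above_def)
      ultimately have 2: "{y\<in>F. x \<le> y} = U" by (rule Umax)
      \<comment> \<open>A chain through \<open>x\<close> splits at \<open>x\<close>, and neither
        half can be larger than the given one.\<close>
      have "F = {y\<in>F. y \<le> x} \<union> {y\<in>F. x \<le> y}"
        using F x by (auto simp: chain_iff)
      then show ?thesis using 1 2 by simp
    qed
    show "pred_on.maxchain UNIV (<) (E \<union> U)"
      unfolding pred_on.maxchain_def using ch max by blast
    have "pred_on.chain UNIV (<) (insert bt (E \<union> U))" "pred_on.chain UNIV (<) (insert tp (E \<union> U))"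
      using ch bt_le le_tp by (auto simp: chain_iff)
    then show "bt \<in> E \<union> U" "tp \<in> E \<union> U" using max by blast+
    have "E \<inter> U = {x}"
      using E1 U by (auto simp: chain_below_def chain_above_def intro: order.antisym)
    then show "card (E \<union> U) + 1 = card E + card U"
      using card_Un_Int[of E U] by simp
  qed
  have "card (E \<union> U) > 0" for E using U by (auto simp: chain_above_def card_gt_0_iff)
  then have "card (C \<union> U) = card (D \<union> U)"
    using maxchain_length[OF mx(1-3)[OF C] mx(1-3)[OF D]] unfolding chain_length_def
    by (metis Suc_pred')
  then show ?thesis using mx(4)[OF C] mx(4)[OF D] by linarith
qed

text \<open>A longest chain with top \<open>x\<close> is saturated, so every saturated one is as
  long. The \<open>Suc\<close> converts length into number of points.\<close>

lemma saturated_below_rank: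
  fixes x :: 'a
  assumes C: "saturated_below x C"
  shows "card C = Suc (poset_rank x)"
proof -
  let ?S = "{chain_length C | C. chain_below x C}"
  have eq: "poset_rank x = Max ?S" unfolding poset_rank_def chain_below_def ..
  have fin: "finite ?S" by simp
  have "chain_below x C" using C by (simp add: saturated_below_def)
  then have "?S \<noteq> {}" by blast
  then have "Max ?S \<in> ?S" using fin by (rule Max_in[rotated])
  then obtain D where D: "chain_below x D" "Max ?S = chain_length D" by auto
  \<comment> \<open>Needed because \<open>chain_length\<close> uses truncated subtraction.\<close>
  have pos: "card E > 0" if "chain_below x E" for E
    using that by (auto simp: chain_below_def card_gt_0_iff)
  have "saturated_below x D" unfolding saturated_below_def
  proof (intro conjI allI impI D)
    fix E assume E: "chain_below x E \<and> D \<subseteq> E"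
    then have "chain_length E \<le> chain_length D" using D(2) fin by (metis (mono_tags, lifting) Max_ge mem_Collect_eq)
    then have "card E \<le> card D" using pos[of E] E pos[OF D(1)] unfolding chain_length_def by linarith
    then show "E = D" using E by (metis card_seteq finite)
  qed
  then have "card C = card D" using C saturated_below_card by blast
  then show ?thesis using D(2) eq pos[OF D(1)] unfolding chain_length_def by simp
qed

lemma exists_saturated_below: "\<exists>C. saturated_below (x::'a) C"
proof -
  have "finite (Collect (chain_below x))" by simp
  moreover have "chain_below x {x}"
    by (auto simp: chain_below_def chain_iff)
  ultimately show ?thesis
    using finite_has_maximal[of "Collect (chain_below x)"] unfolding saturated_below_def by blast
qed

text \<open>A saturated chain below \<open>a\<close> stays saturated when \<open>b\<close> is added,
  since nothing fits between \<open>a\<close> and \<open>b\<close>.\<close>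

lemma rank_covered_by:
  fixes a b :: 'a
  assumes "covered_by a b"
  shows "poset_rank b = Suc (poset_rank a)"
proof -
  obtain C where C: "saturated_below a C" using exists_saturated_below by blast
  then have C1: "chain_below a C" and Cmax: "\<And>V. chain_below a V \<Longrightarrow> C \<subseteq> V \<Longrightarrow> V = C"
    by (auto simp: saturated_below_def)
  have ab: "a < b" and cov: "\<And>c. a < c \<Longrightarrow> c < b \<Longrightarrow> False"
    using assms by (auto simp: covered_by_def)
  have "b \<notin> C" using C1 ab by (auto simp: chain_below_def)
  have "saturated_below b (insert b C)" unfolding saturated_below_def
  proof (intro conjI allI impI)
    show "chain_below b (insert b C)"
      using C1 ab by (auto simp: chain_below_def chain_iff)
    fix E assume E: "chain_below b E \<and> insert b C \<subseteq> E"
    then have aE: "a \<in> E" using C1 by (auto simp: chain_below_def)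
    have le: "y \<le> a" if "y \<in> E" "y \<noteq> b" for y
      using that E aE cov[of y] by (auto simp: chain_below_def chain_iff le_less)
    have "chain_below a (E - {b})"
      using E aE ab le by (auto simp: chain_below_def chain_iff)
    moreover have "C \<subseteq> E - {b}" using E \<open>b \<notin> C\<close> by blast
    ultimately have "E - {b} = C" by (rule Cmax)
    then show "E = insert b C" using E by blast
  qed
  then have "card (insert b C) = Suc (poset_rank b)" by (rule saturated_below_rank)
  then show ?thesis using saturated_below_rank[OF C] \<open>b \<notin> C\<close> by simp
qed

lemma rank_bt: "poset_rank bt = 0"
proof -
  have "saturated_below bt {bt}"
    unfolding saturated_below_def chain_below_def chain_iff
    using bt_le by (auto intro: order.antisym)
  then show ?thesis using saturated_below_rank by fastforce
qed

lemma rank_strict_mono: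
  fixes x y :: 'a
  assumes "x < y"
  shows "poset_rank x < poset_rank y"
  using assms
proof (induction "card {z. z < y}" arbitrary: y rule: less_induct)
  case less
  obtain u where u: "covered_by u y" "x \<le> u" using exists_lower_cover[OF less.prems] by blast
  have "{z. z < u} \<subset> {z. z < y}" using covered_by_less[OF u(1)] by (auto intro: order.strict_trans)
  then have "card {z. z < u} < card {z. z < y}" by (simp add: psubset_card_mono)
  then have "x < u \<Longrightarrow> poset_rank x < poset_rank u" by (rule less.hyps)
  then show ?case using u rank_covered_by[OF u(1)] by (cases "x = u") (auto simp: le_less)
qed

lemma same_rank_incomparable:
  "poset_rank (x::'a) = poset_rank y \<Longrightarrow> x \<noteq> y \<Longrightarrow> \<not> x \<le> y"
  using rank_strict_mono[of x y] by (auto simp: le_less)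

lemma rank_le_tp: "poset_rank (x::'a) \<le> poset_rank tp"
  using rank_strict_mono[of x tp] le_tp[of x] by (auto simp: le_less)

section \<open>Maximal chains indexed by rank\<close>

abbreviation height :: nat where "height \<equiv> poset_rank tp"

text \<open>The index of an element is its rank; values beyond \<open>height\<close> are
  arbitrary.\<close>

definition full_chain :: "(nat \<Rightarrow> 'a) \<Rightarrow> bool"
  where "full_chain c \<longleftrightarrow> c 0 = bt \<and> c height = tp \<and> (\<forall>k<height. covered_by (c k) (c (Suc k)))"

lemma full_chain_cover: "full_chain c \<Longrightarrow> k < height \<Longrightarrow> covered_by (c k) (c (Suc k))"
  by (simp add: full_chain_def)

lemma full_chain_ends: "full_chain c \<Longrightarrow> full_chain d \<Longrightarrow> c 0 = d 0 \<and> c height = d height"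
  by (simp add: full_chain_def)

lemma rank_full_chain: "full_chain c \<Longrightarrow> k \<le> height \<Longrightarrow> poset_rank (c k) = k"
proof (induction k)
  case (Suc k)
  then show ?case using rank_covered_by[OF full_chain_cover, of c k] by simp
qed (simp add: full_chain_def rank_bt)

lemma exists_chain_down:
  "\<exists>c. c 0 = bt \<and> c (poset_rank x) = (x::'a) \<and> (\<forall>k<poset_rank x. covered_by (c k) (c (Suc k)))"
proof (induction "poset_rank x" arbitrary: x)
  case 0
  then have "x = bt" using rank_strict_mono[of bt x] bt_le[of x] by (auto simp: le_less)
  then show ?case using rank_bt by auto
next
  case (Suc m)
  then have "bt < x" using rank_bt bt_le[of x] by (auto simp: le_less)
  then obtain u where u: "covered_by u x" using exists_lower_cover by blast
  then have m: "m = poset_rank u" using rank_covered_by Suc.hyps(2) by simp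
  obtain c where c: "c 0 = bt" "c m = u" "\<forall>k<m. covered_by (c k) (c (Suc k))"
    using Suc.hyps(1)[OF m] m by auto
  have "\<forall>k<Suc m. covered_by ((c(Suc m := x)) k) ((c(Suc m := x)) (Suc k))"
    using c u by (auto simp: less_Suc_eq)
  then show ?case using c by (intro exI[of _ "c(Suc m := x)"]) (simp add: Suc.hyps(2)[symmetric])
qed

lemma exists_chain_up:
  "\<exists>c. c height = tp \<and> c (poset_rank x) = (x::'a) \<and>
     (\<forall>k. poset_rank x \<le> k \<and> k < height \<longrightarrow> covered_by (c k) (c (Suc k)))"
proof (induction "height - poset_rank x" arbitrary: x)
  case 0
  then have "x = tp" using rank_strict_mono[of x tp] le_tp[of x] by (auto simp: le_less)
  then show ?case by auto
next
  case (Suc m)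
  then have "x < tp" using le_tp[of x] by (auto simp: le_less)
  then obtain u where u: "covered_by x u" using exists_upper_cover by blast
  then have r: "poset_rank u = Suc (poset_rank x)" by (rule rank_covered_by)
  then have "m = height - poset_rank u" using Suc.hyps(2) by simp
  from Suc.hyps(1)[OF this] obtain c where c: "c height = tp" "c (Suc (poset_rank x)) = u"
    "\<forall>k. Suc (poset_rank x) \<le> k \<and> k < height \<longrightarrow> covered_by (c k) (c (Suc k))"
    unfolding r by blast
  show ?case using c u Suc.hyps(2)
    by (intro exI[of _ "c(poset_rank x := x)"]) (auto simp: Suc_le_eq)
qed

lemma full_chain_through_edge:
  fixes x u :: 'a
  assumes "covered_by x u"
  obtains c where "full_chain c" "c (poset_rank x) = x" "c (Suc (poset_rank x)) = u"
proof -
  obtain d where d: "d 0 = bt" "d (poset_rank x) = x"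
    "\<forall>k<poset_rank x. covered_by (d k) (d (Suc k))"
    using exists_chain_down by blast
  have r: "poset_rank u = Suc (poset_rank x)" using assms by (rule rank_covered_by)
  obtain e where e: "e height = tp" "e (Suc (poset_rank x)) = u"
    "\<forall>k. Suc (poset_rank x) \<le> k \<and> k < height \<longrightarrow> covered_by (e k) (e (Suc k))"
    using exists_chain_up[of u] unfolding r by blast
  \<comment> \<open>\<open>d\<close> is used up to the level of \<open>x\<close> and
    \<open>e\<close> from the level of \<open>u\<close> on; the given edge joins them.\<close>
  let ?c = "\<lambda>k. if k \<le> poset_rank x then d k else e k"
  have "\<not> height \<le> poset_rank x" using rank_le_tp[of u] r by simp
  moreover have "covered_by (?c k) (?c (Suc k))" if "k < height" for k
    using d e assms that by (cases k "poset_rank x" rule: linorder_cases) auto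
  ultimately have "full_chain ?c" using d e unfolding full_chain_def by auto
  then show thesis using that[of ?c] d e by simp
qed

lemma full_chain_through:
  fixes x :: 'a
  obtains c where "full_chain c" "c (poset_rank x) = x"
proof (cases "x = tp")
  case True
  then show thesis using exists_chain_down[of tp] that unfolding full_chain_def by blast
next
  case False
  then have "x < tp" using le_tp[of x] by (simp add: le_less)
  then obtain u where "covered_by x u" using exists_upper_cover by blast
  then show thesis using full_chain_through_edge that by metis
qed

section \<open>Automorphisms preserve covers and ranks\<close>

lemma automorphism_covered_by:
  assumes "order_automorphism f"
  shows "covered_by (f x) (f y) \<longleftrightarrow> covered_by x (y::'a)"
proof -
  have less: "f a < f b \<longleftrightarrow> a < b" for a b
    using assms unfolding order_automorphism_def by (auto simp: less_le_not_le)
  have "(\<exists>c. f x < c \<and> c < f y) \<longleftrightarrow> (\<exists>c. x < c \<and> c < y)"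
    using assms less unfolding order_automorphism_def by (metis bij_pointE)
  then show ?thesis by (simp add: covered_by_def less)
qed

text \<open>The least element is fixed, and the image of a full chain climbs by covers, each of
  which raises the rank by one.\<close>

lemma automorphism_rank:
  assumes f: "order_automorphism f"
  shows "poset_rank (f x) = poset_rank (x::'a)"
proof -
  have "f bt = bt"
    using f bt_le unfolding order_automorphism_def by (metis bij_pointE order.antisym)
  obtain c where c: "full_chain c" "c (poset_rank x) = x" by (rule full_chain_through)
  have "poset_rank (f (c k)) = k" if "k \<le> height" for k
    using that
  proof (induction k)
    case 0
    then show ?case using \<open>f bt = bt\<close> rank_bt c by (simp add: full_chain_def)
  next
    case (Suc k)
    then have "covered_by (f (c k)) (f (c (Suc k)))"
      using automorphism_covered_by[OF f] full_chain_cover[OF c(1)] by simp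
    then show ?case using rank_covered_by Suc by simp
  qed
  then show ?thesis using c rank_le_tp by metis
qed

end

lemma ranked_imp_graded:
  assumes "ranked TYPE('a::{finite,order})"
  obtains bt tp :: "'a::{finite,order}" where "graded_poset bt tp"
proof -
  obtain bt tp :: 'a where bt: "\<forall>x. bt \<le> x" and tp: "\<forall>x. x \<le> tp"
    and len: "\<forall>C D. pred_on.maxchain UNIV (<) C \<and> bt \<in> C \<and> tp \<in> C \<and>
             pred_on.maxchain UNIV (<) D \<and> bt \<in> D \<and> tp \<in> D
             \<longrightarrow> chain_length C = chain_length D"
    using assms unfolding ranked_def by (elim exE conjE)
  have "graded_poset bt tp"
  proof
    show "bt \<le> x" "x \<le> tp" for x using bt tp by simp_all
    show "chain_length C = chain_length D"
      if "pred_on.maxchain UNIV (<) C" "bt \<in> C" "tp \<in> C"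
        "pred_on.maxchain UNIV (<) D" "bt \<in> D" "tp \<in> D" for C D
      by (rule len[rule_format]) (intro conjI that)
  qed
  then show thesis by (rule that)
qed

section \<open>Curves of a planar drawing\<close>

locale graded_drawing = graded_poset bt tp for bt tp :: "'a::{finite,order}" +
  fixes pos :: "'a \<Rightarrow> real \<times> real" and \<gamma> :: "'a \<Rightarrow> 'a \<Rightarrow> real \<Rightarrow> real \<times> real"
  assumes drawing: "planar_drawing pos \<gamma>"
begin

abbreviation xc :: "'a \<Rightarrow> real" where "xc v \<equiv> fst (pos v)"
abbreviation yc :: "'a \<Rightarrow> real" where "yc v \<equiv> snd (pos v)"

text \<open>Height strictly increases along a drawn edge, so it can replace the curve parameter; the
  value is the horizontal coordinate at height \<open>h\<close>.\<close>

definition edge :: "'a \<Rightarrow> 'a \<Rightarrow> real \<Rightarrow> real"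
  where "edge a b h = fst (\<gamma> a b (inv_into {0..1} (\<lambda>t. snd (\<gamma> a b t)) h))"

text \<open>By the intermediate value theorem the height maps \<open>{0..1}\<close> onto
  \<open>{yc a..yc b}\<close>, and its inverse is continuous by compactness. Hence the drawn edge is
  the graph of a continuous function.\<close>

lemma edge_props:
  assumes "covered_by a b"
  shows edge_path_image: "(x, h) \<in> path_image (\<gamma> a b) \<longleftrightarrow> yc a \<le> h \<and> h \<le> yc b \<and> x = edge a b h"
    and edge_continuous: "continuous_on {yc a..yc b} (edge a b)"
    and yc_less: "yc a < yc b"
    and edge_start: "edge a b (yc a) = xc a"
    and edge_finish: "edge a b (yc b) = xc b"
proof -
  let ?p = "\<lambda>t. snd (\<gamma> a b t)" and ?q = "inv_into {0..1} (\<lambda>t. snd (\<gamma> a b t))"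
  have path: "continuous_on {0..1} (\<gamma> a b)" and ends: "\<gamma> a b 0 = pos a" "\<gamma> a b 1 = pos b"
    and mono: "strict_mono_on {0..1} ?p"
    using drawing assms unfolding planar_drawing_def path_def pathstart_def pathfinish_def by auto
  have inj: "inj_on ?p {0..1}" using mono by (rule strict_mono_on_imp_inj_on)
  have cp: "continuous_on {0..1} ?p" by (intro continuous_intros path)
  show "yc a < yc b" using strict_mono_onD[OF mono, of 0 1] ends by simp
  have q: "?q (?p t) = t" if "t \<in> {0..1}" for t
    using inv_into_f_f[OF inj that] .
  have img: "?p ` {0..1} = {yc a..yc b}"
  proof
    show "?p ` {0..1} \<subseteq> {yc a..yc b}"
      using strict_mono_on_leD[OF mono, of 0] strict_mono_on_leD[OF mono, of _ 1] ends by auto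
    show "{yc a..yc b} \<subseteq> ?p ` {0..1}"
    proof
      fix h assume "h \<in> {yc a..yc b}"
      then have "\<exists>t\<ge>0. t \<le> 1 \<and> ?p t = h" using IVT'[of ?p 0 h 1] cp ends by auto
      then show "h \<in> ?p ` {0..1}" by auto
    qed
  qed
  have cq: "continuous_on {yc a..yc b} ?q"
    using continuous_on_inv[OF cp, of ?q] q img by simp
  have "?q ` {yc a..yc b} \<subseteq> {0..1}" using q img by (metis image_subsetI inv_into_into)
  then show "continuous_on {yc a..yc b} (edge a b)"
    unfolding edge_def[abs_def]
    by (intro continuous_intros continuous_on_compose2[OF path cq])
  have e: "edge a b (?p t) = fst (\<gamma> a b t)" if "t \<in> {0..1}" for t
    unfolding edge_def using q[OF that] by simp
  show "edge a b (yc a) = xc a" "edge a b (yc b) = xc b"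
    using e[of 0] e[of 1] ends by auto
  have "path_image (\<gamma> a b) = (\<lambda>t. (edge a b (?p t), ?p t)) ` {0..1}"
    unfolding path_image_def using e by (intro image_cong) (auto simp: prod_eq_iff)
  also have "\<dots> = (\<lambda>h. (edge a b h, h)) ` {yc a..yc b}"
    unfolding img[symmetric] by (simp add: image_image)
  finally show "(x, h) \<in> path_image (\<gamma> a b) \<longleftrightarrow> yc a \<le> h \<and> h \<le> yc b \<and> x = edge a b h"
    by auto
qed

section \<open>Chains as graphs over the vertical axis\<close>

lemma yc_chain_less:
  assumes c: "full_chain c" and "j < k" "k \<le> height"
  shows "yc (c j) < yc (c k)"
  using assms(2,3)
proof (induction k)
  case (Suc k)
  then have "yc (c k) < yc (c (Suc k))" using yc_less[OF full_chain_cover[OF c]] by simp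
  then show ?case using Suc by (cases "j = k") auto
qed simp

lemma yc_chain_le: "full_chain c \<Longrightarrow> j \<le> k \<Longrightarrow> k \<le> height \<Longrightarrow> yc (c j) \<le> yc (c k)"
  using yc_chain_less[of c j k] by (cases "j = k") auto

lemma yc_chain_less_iff:
  "full_chain c \<Longrightarrow> j \<le> height \<Longrightarrow> k \<le> height \<Longrightarrow> yc (c j) < yc (c k) \<longleftrightarrow> j < k"
  using yc_chain_less[of c j k] yc_chain_le[of c k j] by (meson not_less)

lemma chain_segment:
  assumes c: "full_chain c" and "p < q" "q \<le> height" "yc (c p) \<le> h" "h \<le> yc (c q)"
  obtains k where "p \<le> k" "k < q" "yc (c k) \<le> h" "h \<le> yc (c (Suc k))"
proof -
  have "\<exists>k\<ge>p. k < q \<and> yc (c k) \<le> h \<and> h \<le> yc (c (Suc k))"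
    using assms(2-)
  proof (induction q)
    case (Suc q)
    show ?case
    proof (cases "p < q \<and> h \<le> yc (c q)")
      case True
      then show ?thesis using Suc by (metis Suc_leD less_SucI)
    next
      case False
      then have "yc (c q) \<le> h" "p \<le> q" using Suc.prems by (auto simp: less_Suc_eq)
      then show ?thesis using Suc.prems by blast
    qed
  qed simp
  then show thesis using that by blast
qed

text \<open>The edges of the chain joined into one function of the height. At the height of an inner
  vertex \<open>LEAST\<close> selects the edge that ends there; \<open>curve_eq_edge\<close> shows
  that the edge starting there gives the same value.\<close>

definition curve :: "(nat \<Rightarrow> 'a) \<Rightarrow> real \<Rightarrow> real"
  where "curve c h = (let k = (LEAST k. h \<le> yc (c (Suc k))) in edge (c k) (c (Suc k)) h)"

lemma curve_eq_edge:
  assumes c: "full_chain c" and k: "k < height" and h: "yc (c k) \<le> h" "h \<le> yc (c (Suc k))"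
  shows "curve c h = edge (c k) (c (Suc k)) h"
proof -
  define j where "j = (LEAST k. h \<le> yc (c (Suc k)))"
  have j: "h \<le> yc (c (Suc j))" "j \<le> k"
    unfolding j_def using h(2) by (auto intro: LeastI Least_le)
  show ?thesis
  proof (cases "j = k")
    case True
    then show ?thesis unfolding curve_def j_def by (simp add: Let_def)
  next
    case False
    \<comment> \<open>Heights increase strictly along the chain, so two different edges reach height
      \<open>h\<close> only if they are adjacent and \<open>h\<close> is the height of their common
      vertex.\<close>
    then have "Suc j \<le> k" using j by simp
    then have "yc (c (Suc j)) \<le> yc (c k)" using yc_chain_le[OF c, of "Suc j" k] k by simp
    then have eq: "h = yc (c (Suc j))" "h = yc (c k)" using j h by auto
    then have "Suc j = k"
      using yc_chain_less[OF c, of "Suc j" k] k \<open>Suc j \<le> k\<close> by (cases "Suc j = k") auto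
    then have "edge (c j) (c (Suc j)) h = xc (c k)"
      using edge_finish[OF full_chain_cover[OF c, of j]] k eq by auto
    then have "curve c h = xc (c k)"
      unfolding curve_def j_def[symmetric] Let_def .
    then show ?thesis
      using edge_start[OF full_chain_cover[OF c k]] eq(2) by simp
  qed
qed

lemma curve_continuous:
  assumes c: "full_chain c"
  shows "continuous_on {yc (c 0)..yc (c height)} (curve c)"
proof -
  have "continuous_on {yc (c 0)..yc (c m)} (curve c)" if "m \<le> height" for m
    using that
  proof (induction m)
    case (Suc m)
    have "continuous_on {yc (c m)..yc (c (Suc m))} (curve c)"
      using edge_continuous[OF full_chain_cover[OF c]] curve_eq_edge[OF c] Suc.prems
      by (subst continuous_on_cong[OF refl, of _ _ "edge (c m) (c (Suc m))"]) auto
    then have "continuous_on ({yc (c 0)..yc (c m)} \<union> {yc (c m)..yc (c (Suc m))}) (curve c)"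
      using Suc by (intro continuous_on_closed_Un) auto
    moreover have "{yc (c 0)..yc (c m)} \<union> {yc (c m)..yc (c (Suc m))} = {yc (c 0)..yc (c (Suc m))}"
      using yc_chain_le[OF c, of 0 m] yc_chain_le[OF c, of m "Suc m"] Suc.prems
      by (intro ivl_disj_un_two_touch) auto
    ultimately show ?case by simp
  qed simp
  then show ?thesis by simp
qed

text \<open>For \<open>height = 0\<close> the chain has no edges and \<open>curve\<close> would read
  indices beyond it, hence the condition. The top vertex is reached by the edge ending there, every
  other one by the edge starting there.\<close>

lemma curve_vertex:
  assumes c: "full_chain c" and "0 < height" "k \<le> height"
  shows "curve c (yc (c k)) = xc (c k)"
proof (cases "k < height")
  case True
  then show ?thesis
    using curve_eq_edge[OF c True, of "yc (c k)"] yc_less[OF full_chain_cover[OF c True]]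
      edge_start[OF full_chain_cover[OF c True]] by simp
next
  case False
  then obtain j where j: "k = Suc j" "j < height" using assms by (cases k) auto
  then show ?thesis
    using curve_eq_edge[OF c j(2), of "yc (c k)"] yc_less[OF full_chain_cover[OF c j(2)]]
      edge_finish[OF full_chain_cover[OF c j(2)]] by simp
qed

text \<open>A common value at one height is a common point of two drawn edges. Planarity makes it a
  common vertex unless the edges coincide, and ranks force equal indices in both chains.\<close>

lemma curves_meet:
  assumes c: "full_chain c" and d: "full_chain d"
    and j: "j < height" "yc (c j) \<le> h" "h \<le> yc (c (Suc j))"
    and k: "k < height" "yc (d k) \<le> h" "h \<le> yc (d (Suc k))"
    and eq: "curve c h = curve d h"
  shows "(\<exists>i\<le>height. c i = d i \<and> h = yc (c i)) \<or> (c j = d j \<and> c (Suc j) = d (Suc j))"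
proof (cases "(c j, c (Suc j)) = (d k, d (Suc k))")
  case True
  then have "j = k"
    using rank_full_chain[OF c, of j] rank_full_chain[OF d, of k] j k by simp
  then show ?thesis using True by simp
next
  case False
  note cj = full_chain_cover[OF c j(1)] and dk = full_chain_cover[OF d k(1)]
  have "(curve c h, h) \<in> path_image (\<gamma> (c j) (c (Suc j)))"
    using edge_path_image[OF cj] curve_eq_edge[OF c j] j by simp
  moreover have "(curve c h, h) \<in> path_image (\<gamma> (d k) (d (Suc k)))"
    unfolding eq using edge_path_image[OF dk] curve_eq_edge[OF d k] k by simp
  ultimately have "(curve c h, h) \<in> pos ` ({c j, c (Suc j)} \<inter> {d k, d (Suc k)})"
    using drawing cj dk False unfolding planar_drawing_def by blast
  then obtain v where v: "v \<in> {c j, c (Suc j)}" "v \<in> {d k, d (Suc k)}" "(curve c h, h) = pos v"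
    by blast
  obtain i where i: "i \<le> height" "v = c i" using v(1) j(1) by (metis Suc_leI insertE less_imp_le singletonD)
  obtain i' where i': "i' \<le> height" "v = d i'" using v(2) k(1) by (metis Suc_leI insertE less_imp_le singletonD)
  have "i = i'" using i i' rank_full_chain c d by metis
  moreover have "h = yc v" using v(3) by (metis snd_conv)
  ultimately show ?thesis using i i' by blast
qed

text \<open>Between two consecutive common vertices the curves of two chains bound a region, hence one of
  them stays strictly to the left of the other.\<close>

lemma curves_bigon:
  assumes c: "full_chain c" and d: "full_chain d" and i: "i \<le> height" and ne: "c i \<noteq> d i"
  obtains p q where "p < i" "i < q" "q \<le> height" "c p = d p" "c q = d q"
    and "\<And>k. p < k \<Longrightarrow> k < q \<Longrightarrow> c k \<noteq> d k"
    and "(\<forall>h\<in>{yc (c p)<..<yc (c q)}. curve c h < curve d h) \<or>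
         (\<forall>h\<in>{yc (c p)<..<yc (c q)}. curve d h < curve c h)"
proof -
  \<comment> \<open>The nearest agreements of the chains on both sides of \<open>i\<close>; they
    exist because the chains share both ends.\<close>
  define p where "p = Max {k. k \<le> i \<and> c k = d k}"
  define q where "q = (LEAST k. i \<le> k \<and> c k = d k)"
  have ends: "c 0 = d 0" "c height = d height" using full_chain_ends[OF c d] by auto
  have "p \<in> {k. k \<le> i \<and> c k = d k}" unfolding p_def using ends by (intro Max_in) auto
  then have p: "p < i" "c p = d p" using ne by (auto simp: le_less)
  have pmax: "k \<le> p" if "k \<le> i" "c k = d k" for k unfolding p_def using that by (intro Max_ge) auto
  have "i \<le> q \<and> c q = d q" unfolding q_def by (rule LeastI[of _ height]) (use i ends in auto)
  then have q: "i < q" "c q = d q" using ne by (auto simp: le_less)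
  have qmin: "q \<le> k" if "i \<le> k" "c k = d k" for k unfolding q_def using that by (intro Least_le) auto
  have qh: "q \<le> height" using qmin[OF i] ends by simp
  have between: "c k \<noteq> d k" if "p < k" "k < q" for k
    using pmax[of k] qmin[of k] that by (cases "k \<le> i") auto
  let ?I = "{yc (c p)<..<yc (c q)}"
  have noteq: "curve c h \<noteq> curve d h" if h: "h \<in> ?I" for h
  proof
    assume eq: "curve c h = curve d h"
    have pq: "p < q" using p q by simp
    obtain j where j: "p \<le> j" "j < q" "yc (c j) \<le> h" "h \<le> yc (c (Suc j))"
      using chain_segment[OF c pq qh, of h] h by auto
    obtain k where k: "p \<le> k" "k < q" "yc (d k) \<le> h" "h \<le> yc (d (Suc k))"
      using chain_segment[OF d pq qh, of h] h p q by auto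
    have "(\<exists>i\<le>height. c i = d i \<and> h = yc (c i)) \<or> (c j = d j \<and> c (Suc j) = d (Suc j))"
      using curves_meet[OF c d _ j(3,4) _ k(3,4) eq] j k qh by simp
    then show False
    proof
      assume "\<exists>i\<le>height. c i = d i \<and> h = yc (c i)"
      then obtain m where m: "m \<le> height" "c m = d m" "h = yc (c m)" by blast
      then have "p < m" "m < q" using h yc_chain_less_iff[OF c, of p m] yc_chain_less_iff[OF c, of m q] pq qh by auto
      then show False using between m by blast
    next
      \<comment> \<open>A shared edge would have to run from index \<open>p\<close> to index
        \<open>q\<close>, leaving no room for \<open>i\<close>.\<close>
      assume "c j = d j \<and> c (Suc j) = d (Suc j)"
      then have "\<not> p < j" "\<not> Suc j < q"
        using between[of j] between[of "Suc j"] j(1,2) le_imp_less_Suc by blast+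
      then show False using j(1,2) p q by linarith
    qed
  qed
  have sub: "?I \<subseteq> {yc (c 0)..yc (c height)}"
    using yc_chain_le[OF c, of 0 p] yc_chain_le[OF c, of q height] p q i qh by auto
  have "continuous_on ?I (curve c)" "continuous_on ?I (curve d)"
    using curve_continuous[OF c] curve_continuous[OF d] sub ends by (auto intro: continuous_on_subset)
  \<comment> \<open>The difference is continuous without zeros on an interval, so its sign is
    constant.\<close>
  then have "continuous_on ?I (\<lambda>h. curve d h - curve c h)" by (intro continuous_intros)
  then have "connected ((\<lambda>h. curve d h - curve c h) ` ?I)"
    by (rule connected_continuous_image) simp
  then have conn: "\<And>x y z. x \<in> (\<lambda>h. curve d h - curve c h) ` ?I \<Longrightarrow>
      y \<in> (\<lambda>h. curve d h - curve c h) ` ?I \<Longrightarrow> x \<le> z \<Longrightarrow> z \<le> y \<Longrightarrow>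
      z \<in> (\<lambda>h. curve d h - curve c h) ` ?I"
    unfolding connected_iff_interval by blast
  have "(\<forall>h\<in>?I. curve c h < curve d h) \<or> (\<forall>h\<in>?I. curve d h < curve c h)"
  proof (rule ccontr)
    assume "\<not> ?thesis"
    then obtain g h where gh: "g \<in> ?I" "h \<in> ?I"
      and "\<not> curve c g < curve d g" "\<not> curve d h < curve c h"
      by blast
    then have "curve d g - curve c g \<le> 0" "0 \<le> curve d h - curve c h" by auto
    then have "0 \<in> (\<lambda>h. curve d h - curve c h) ` ?I"
      using conn[OF imageI[OF gh(1)] imageI[OF gh(2)]] by blast
    then obtain k where "k \<in> ?I" "0 = curve d k - curve c k" by (rule imageE)
    then show False using noteq[of k] by simp
  qed
  then show thesis using that p q qh between by blast
qed

section \<open>The left-to-right order of a level\<close>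

text \<open>Vertices of one level may be drawn at different heights, so \<open>x\<close> is compared
  with a curve through \<open>y\<close> at the height of \<open>x\<close>. The choice of the chains
  turns out to be irrelevant.\<close>

definition left_of :: "'a \<Rightarrow> 'a \<Rightarrow> bool"
  where "left_of x y \<longleftrightarrow> poset_rank x = poset_rank y \<and> x \<noteq> y \<and>
    (\<exists>c d. full_chain c \<and> full_chain d \<and> c (poset_rank x) = x \<and> d (poset_rank y) = y \<and>
       curve c (yc x) < curve d (yc x))"

text \<open>The heights of \<open>c i\<close> and \<open>d i\<close> both lie inside the bigon
  around level \<open>i\<close>, where one curve stays strictly on one side of the other.\<close>

lemma curve_sides:
  assumes c: "full_chain c" and d: "full_chain d" and i: "i \<le> height" and ne: "c i \<noteq> d i"
  shows "curve c (yc (c i)) < curve d (yc (c i)) \<longleftrightarrow> curve c (yc (d i)) < curve d (yc (d i))"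
    and "curve c (yc (c i)) < curve d (yc (c i)) \<longleftrightarrow> \<not> curve d (yc (d i)) < curve c (yc (d i))"
proof -
  obtain p q where pq: "p < i" "i < q" "q \<le> height" "c p = d p" "c q = d q"
    and s: "(\<forall>h\<in>{yc (c p)<..<yc (c q)}. curve c h < curve d h) \<or>
         (\<forall>h\<in>{yc (c p)<..<yc (c q)}. curve d h < curve c h)"
    using curves_bigon[OF assms] by metis
  have "yc (c i) \<in> {yc (c p)<..<yc (c q)}"
    using yc_chain_less[OF c, of p i] yc_chain_less[OF c, of i q] pq i by auto
  moreover have "yc (d i) \<in> {yc (c p)<..<yc (c q)}"
    using yc_chain_less[OF d, of p i] yc_chain_less[OF d, of i q] pq i by auto
  ultimately have
    "curve c (yc (c i)) < curve d (yc (c i)) \<and> curve c (yc (d i)) < curve d (yc (d i)) \<or>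
     curve d (yc (c i)) < curve c (yc (c i)) \<and> curve d (yc (d i)) < curve c (yc (d i))"
    using s by blast
  then show "curve c (yc (c i)) < curve d (yc (c i)) \<longleftrightarrow> curve c (yc (d i)) < curve d (yc (d i))"
    "curve c (yc (c i)) < curve d (yc (c i)) \<longleftrightarrow> \<not> curve d (yc (d i)) < curve c (yc (d i))"
    by auto
qed

text \<open>One side of \<open>curve_sides(2)\<close> involves \<open>c\<close> only through the vertex \<open>c i\<close>, the other involves \<open>d\<close>
  only through \<open>d i\<close>; so the comparison depends only on the two vertices.\<close>

lemma left_of_iff:
  assumes c: "full_chain c" and d: "full_chain d" and i: "i \<le> height" and ne: "c i \<noteq> d i"
  shows "left_of (c i) (d i) \<longleftrightarrow> curve c (yc (c i)) < curve d (yc (c i))"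
proof
  assume "curve c (yc (c i)) < curve d (yc (c i))"
  then show "left_of (c i) (d i)"
    unfolding left_of_def using c d ne rank_full_chain[OF c i] rank_full_chain[OF d i] by metis
next
  assume "left_of (c i) (d i)"
  then obtain c' d' where c': "full_chain c'" "c' i = c i" and d': "full_chain d'" "d' i = d i"
    and less: "curve c' (yc (c i)) < curve d' (yc (c i))"
    unfolding left_of_def using rank_full_chain[OF c i] rank_full_chain[OF d i] by metis
  have "0 < height" using ne i full_chain_ends[OF c d] by (cases "height = 0") auto
  note v = curve_vertex[OF _ this i]
  have "curve c (yc (c i)) < curve d' (yc (c i))"
    using less v[OF c] v[OF c'(1)] c' by simp
  then have "\<not> curve d' (yc (d i)) < curve c (yc (d i))"
    using curve_sides(2)[OF c d'(1) i] d' ne by simp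
  then have "\<not> curve d (yc (d i)) < curve c (yc (d i))"
    using v[OF d] v[OF d'(1)] d' by simp
  then show "curve c (yc (c i)) < curve d (yc (c i))"
    using curve_sides(2)[OF c d i ne] by simp
qed

text \<open>Exchanging the two chains in \<open>left_of_iff\<close> turns one side of
  \<open>curve_sides(2)\<close> into the other.\<close>

lemma left_of_total:
  assumes "poset_rank x = poset_rank y" "x \<noteq> y"
  shows "left_of x y \<longleftrightarrow> \<not> left_of y x"
proof -
  obtain c where c: "full_chain c" "c (poset_rank x) = x" by (rule full_chain_through)
  obtain d where d: "full_chain d" "d (poset_rank x) = y" by (rule full_chain_through[of y]) (simp add: assms)
  show ?thesis
    using left_of_iff[OF c(1) d(1) rank_le_tp] left_of_iff[OF d(1) c(1) rank_le_tp]
      curve_sides(2)[OF c(1) d(1) rank_le_tp] c d assms by metis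
qed

lemma left_of_rank: "left_of x y \<Longrightarrow> poset_rank x = poset_rank y"
  by (simp add: left_of_def)

lemma left_of_neq: "left_of x y \<Longrightarrow> x \<noteq> y"
  by (simp add: left_of_def)

text \<open>Chains through the two edges differ at both levels, so both levels lie in the same bigon
  and the sides agree.\<close>

lemma left_of_noncrossing:
  assumes xy: "left_of x y" and x: "covered_by x u" and y: "covered_by y v" and "u \<noteq> v"
  shows "left_of u v"
proof -
  define i where "i = poset_rank x"
  obtain c where c: "full_chain c" "c i = x" "c (Suc i) = u"
    using full_chain_through_edge[OF x] i_def by blast
  obtain d where d: "full_chain d" "d i = y" "d (Suc i) = v"
    using full_chain_through_edge[OF y] i_def left_of_rank[OF xy] by metis
  have i: "Suc i \<le> height" "i \<le> height"
    using rank_covered_by[OF x] rank_le_tp[of u] i_def by auto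
  have "c i \<noteq> d i" using c d left_of_neq[OF xy] by simp
  then obtain p q where pq: "p < i" "i < q" "q \<le> height" "c p = d p" "c q = d q"
    and s: "(\<forall>h\<in>{yc (c p)<..<yc (c q)}. curve c h < curve d h) \<or>
         (\<forall>h\<in>{yc (c p)<..<yc (c q)}. curve d h < curve c h)"
    using curves_bigon[OF c(1) d(1) i(2)] by metis
  have "Suc i < q" using pq c d \<open>u \<noteq> v\<close> by (cases "Suc i = q") auto
  then have "yc (c i) \<in> {yc (c p)<..<yc (c q)}" "yc (c (Suc i)) \<in> {yc (c p)<..<yc (c q)}"
    using pq i yc_chain_less[OF c(1), of p i] yc_chain_less[OF c(1), of i q]
      yc_chain_less[OF c(1), of p "Suc i"] yc_chain_less[OF c(1), of "Suc i" q] by auto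
  moreover have "curve c (yc (c i)) < curve d (yc (c i))"
    using left_of_iff[OF c(1) d(1) i(2) \<open>c i \<noteq> d i\<close>] xy c d by simp
  ultimately have "curve c (yc (c (Suc i))) < curve d (yc (c (Suc i)))"
    using s by (meson order.asym)
  then show ?thesis using left_of_iff[OF c(1) d(1) i(1)] c d \<open>u \<noteq> v\<close> by simp
qed

text \<open>The chain through \<open>x\<close> can be rerouted along the chain through \<open>y\<close> outside their bigon; the
  new curve is weakly to the left of the curve through \<open>y\<close> everywhere.\<close>

lemma left_of_trans:
  assumes xy: "left_of x y" and yz: "left_of y z"
  shows "left_of x z"
proof -
  define i where "i = poset_rank x"
  have r: "poset_rank y = i" "poset_rank z = i"
    using left_of_rank[OF xy] left_of_rank[OF yz] i_def by auto
  obtain c where c: "full_chain c" "c i = x" using full_chain_through[of x] i_def by metis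
  obtain d where d: "full_chain d" "d i = y" using full_chain_through[of y] r by metis
  obtain e where e: "full_chain e" "e i = z" using full_chain_through[of z] r by metis
  have i: "i \<le> height" unfolding i_def by (rule rank_le_tp)
  have ne: "c i \<noteq> d i" "d i \<noteq> e i" using c d e left_of_neq[OF xy] left_of_neq[OF yz] by auto
  have h0: "0 < height" using ne i full_chain_ends[OF c(1) d(1)] by (cases "height = 0") auto
  obtain p q where pq: "p < i" "i < q" "q \<le> height" "c p = d p" "c q = d q"
    and s: "(\<forall>h\<in>{yc (c p)<..<yc (c q)}. curve c h < curve d h) \<or>
         (\<forall>h\<in>{yc (c p)<..<yc (c q)}. curve d h < curve c h)"
    using curves_bigon[OF c(1) d(1) i ne(1)] by metis
  have "yc (c i) \<in> {yc (c p)<..<yc (c q)}"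
    using pq i yc_chain_less[OF c(1), of p i] yc_chain_less[OF c(1), of i q]
      yc_chain_less[OF c(1), of p "Suc i"] yc_chain_less[OF c(1), of "Suc i" q] by auto
  moreover have "curve c (yc (c i)) < curve d (yc (c i))"
    using left_of_iff[OF c(1) d(1) i ne(1)] xy c d by simp
  ultimately have s: "curve c h < curve d h" if "yc (c p) < h" "h < yc (c q)" for h
    using s that by (meson greaterThanLessThan_iff order.asym)
  define c' where "c' = (\<lambda>k. if p \<le> k \<and> k \<le> q then c k else d k)"
  have c'_in: "c' j = c j" if "p \<le> j" "j \<le> q" for j using that by (simp add: c'_def)
  \<comment> \<open>At \<open>p\<close> and \<open>q\<close> both descriptions of \<open>c'\<close>
    apply, since \<open>c\<close> and \<open>d\<close> agree there; this makes the covers at the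
    joints work.\<close>
  have c'_out: "c' j = d j" if "j \<le> p \<or> q \<le> j" for j
    using that pq by (auto simp: c'_def)
  have c': "full_chain c'"
    unfolding full_chain_def
  proof (intro conjI allI impI)
    show "c' 0 = bt" "c' height = tp" using c'_out pq d by (auto simp: full_chain_def)
    fix k assume "k < height"
    then show "covered_by (c' k) (c' (Suc k))"
      using full_chain_cover[OF c(1), of k] full_chain_cover[OF d(1), of k]
        c'_in[of k] c'_in[of "Suc k"] c'_out[of k] c'_out[of "Suc k"]
      by (cases "p \<le> k \<and> k < q") (auto simp: not_le not_less Suc_le_eq)
  qed
  have local: "curve a h = curve b h"
    if "full_chain a" "full_chain b" "j < height" "a j = b j" "a (Suc j) = b (Suc j)"
      "yc (a j) \<le> h" "h \<le> yc (a (Suc j))" for a b j h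
    using that curve_eq_edge[of a j h] curve_eq_edge[of b j h] by simp
  have le: "curve c' h \<le> curve d h" if h: "yc (c' 0) \<le> h" "h \<le> yc (c' height)" for h
  proof -
    obtain j where j: "j < height" "yc (c' j) \<le> h" "h \<le> yc (c' (Suc j))"
      using chain_segment[OF c' h0 order.refl h] by metis
    show ?thesis
    proof (cases "p \<le> j \<and> j < q")
      case True
      have eq: "c' j = c j" "c' (Suc j) = c (Suc j)" using True by (auto intro!: c'_in)
      have *: "curve c' h = curve c h" using local[OF c' c(1) j(1) eq j(2,3)] .
      have "yc (c p) \<le> h" "h \<le> yc (c q)"
        using j eq yc_chain_le[OF c(1), of p j] yc_chain_le[OF c(1), of "Suc j" q] True pq by auto
      moreover have "curve c (yc (c p)) = curve d (yc (c p))"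
        using curve_vertex[OF c(1) h0, of p] curve_vertex[OF d(1) h0, of p] pq i by simp
      moreover have "curve c (yc (c q)) = curve d (yc (c q))"
        using curve_vertex[OF c(1) h0, of q] curve_vertex[OF d(1) h0, of q] pq i by simp
      \<comment> \<open>Strict inside the bigon, equality at its two end vertices.\<close>
      ultimately show ?thesis unfolding * using s[of h] by (auto simp: le_less)
    next
      case False
      then have "c' j = d j" "c' (Suc j) = d (Suc j)" by (auto intro!: c'_out)
      then show ?thesis using local[OF c' d(1) j(1) _ _ j(2,3)] by simp
    qed
  qed
  \<comment> \<open>The comparison is made at the height of \<open>z\<close>;
    \<open>curve_sides(1)\<close> moves the hypothesis on \<open>y\<close> and \<open>z\<close>
    there.\<close>
  have "yc (c' 0) \<le> yc (e i)" "yc (e i) \<le> yc (c' height)"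
    using yc_chain_le[OF e(1), of 0 i] yc_chain_le[OF e(1), of i height] i full_chain_ends[OF c' e(1)]
    by auto
  then have "curve c' (yc (e i)) \<le> curve d (yc (e i))" by (rule le)
  also have "\<dots> < curve e (yc (e i))"
    using left_of_iff[OF d(1) e(1) i ne(2)] curve_sides(1)[OF d(1) e(1) i ne(2)] yz d e by simp
  finally have less: "curve c' (yc (e i)) < curve e (yc (e i))" .
  \<comment> \<open>Otherwise \<open>x\<close> and \<open>y\<close> would be left of each
    other.\<close>
  have "x \<noteq> z" using xy yz left_of_total[of x y] left_of_rank left_of_neq by blast
  moreover have "c' i = x" using c'_in[of i] pq c by simp
  ultimately show ?thesis
    using left_of_iff[OF c' e(1) i] curve_sides(1)[OF c' e(1) i] less e by simp
qed

text \<open>The position in the level, counted from 0 at the left; as a number it also serves as an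
  induction measure.\<close>

definition place :: "'a \<Rightarrow> nat"
  where "place x = card {y. left_of y x}"

text \<open>Transitivity makes the sets of vertices to the left strictly nested; totality gives the
  converse.\<close>

lemma left_of_iff_place:
  assumes "poset_rank x = poset_rank y"
  shows "left_of x y \<longleftrightarrow> place x < place y"
proof -
  have less: "place a < place b" if "left_of a b" for a b
  proof -
    have "a \<in> {y. left_of y b} - {y. left_of y a}" using that left_of_neq by blast
    moreover have "{y. left_of y a} \<subseteq> {y. left_of y b}" using that left_of_trans by blast
    ultimately have "{y. left_of y a} \<subset> {y. left_of y b}" by blast
    then show ?thesis unfolding place_def by (simp add: psubset_card_mono)
  qed
  show ?thesis
  proof
    assume "place x < place y"
    then show "left_of x y" using left_of_total[OF assms] less[of y x] by auto
  qed (rule less)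
qed

lemma place_inject: "poset_rank x = poset_rank y \<Longrightarrow> place x = place y \<Longrightarrow> x = y"
  using left_of_total[of x y] left_of_iff_place[of x y] left_of_iff_place[of y x] by auto

text \<open>Together with \<open>place_inject\<close> this is all that the later arguments use about
  the drawing.\<close>

lemma place_noncrossing:
  assumes "covered_by a b" "covered_by a' b'" "poset_rank a = poset_rank a'" "place a < place a'"
  shows "place b \<le> place b'"
proof (cases "b = b'")
  case False
  have "left_of b b'"
    using left_of_noncrossing[OF _ assms(1,2) False] left_of_iff_place assms(3,4) by simp
  then show ?thesis using left_of_iff_place[of b b'] left_of_rank by simp
qed simp

end

section \<open>Automorphisms fixing the leftmost vertex of every level\<close>

locale rank_connected_drawing = graded_drawing bt tp pos \<gamma>
  for bt tp :: "'a::{finite,order}" and pos \<gamma> +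
  assumes level_connected: "covered_by (a::'a) b \<Longrightarrow>
    hasse_connected_on {x::'a. poset_rank x = poset_rank a \<or> poset_rank x = Suc (poset_rank a)}"
begin

definition leftmost :: "'a \<Rightarrow> bool"
  where "leftmost x \<longleftrightarrow> (\<forall>y. poset_rank y = poset_rank x \<longrightarrow> place x \<le> place y)"

text \<open>Otherwise the vertices weakly to the right of the given edge form a union of components of
  the graph on the two levels, so they are all its vertices.\<close>

lemma earlier_adjacent_edge:
  assumes ab: "covered_by a b"
  obtains (leftmost) "leftmost a" "leftmost b"
    | (lower) b' where "covered_by a b'" "place b' < place b"
    | (upper) a' where "covered_by a' b" "place a' < place a"
proof (rule ccontr)
  assume nt: "\<not> thesis"
  have no_low: "place b \<le> place b'" if "covered_by a b'" for b'
    using lower[OF that] nt by (meson not_less)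
  have no_up: "place a \<le> place a'" if "covered_by a' b" for a'
    using upper[OF that] nt by (meson not_less)
  define V where "V = {x::'a. poset_rank x = poset_rank a \<or> poset_rank x = Suc (poset_rank a)}"
  define S where "S = {x. poset_rank x = poset_rank a \<and> place a \<le> place x \<or>
    poset_rank x = poset_rank b \<and> place b \<le> place x}"
  have rb: "poset_rank b = Suc (poset_rank a)" using ab by (rule rank_covered_by)
  have closed: "x \<in> S \<longleftrightarrow> y \<in> S" if xy: "covered_by x y" and V: "x \<in> V" "y \<in> V" for x y
  proof -
    have "poset_rank y = Suc (poset_rank x)" using xy by (rule rank_covered_by)
    then have rx: "poset_rank x = poset_rank a" and ry: "poset_rank y = poset_rank b"
      using V rb by (auto simp: V_def)
    have "place a \<le> place x \<longleftrightarrow> place b \<le> place y"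
    proof
      assume "place a \<le> place x"
      then show "place b \<le> place y"
        using place_noncrossing[OF ab xy rx[symmetric]] no_low[of y] xy place_inject[OF rx]
        by (auto simp: le_less)
    next
      assume *: "place b \<le> place y"
      show "place a \<le> place x"
      proof (rule ccontr)
        \<comment> \<open>If \<open>x\<close> were left of \<open>a\<close>, noncrossing would force
          \<open>y = b\<close>, and \<open>x\<close> would be an earlier lower neighbour of
          \<open>b\<close>.\<close>
        assume "\<not> place a \<le> place x"
        then have "place x < place a" by simp
        then have "place y \<le> place b" using place_noncrossing[OF xy ab rx] by simp
        then have "y = b" using * place_inject[OF ry] by simp
        then show False using no_up xy \<open>\<not> place a \<le> place x\<close> by blast
      qed
    qed
    then show ?thesis using rx ry rb by (auto simp: S_def)
  qed
  have all: "x \<in> S" if "x \<in> V" for x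
  proof -
    have "a \<in> V" by (simp add: V_def)
    then have "(a, x) \<in> (hasse_edges_on V)\<^sup>*"
      using level_connected[OF ab] that unfolding hasse_connected_on_def V_def by blast
    then show ?thesis
    proof (induction rule: rtrancl_induct)
      case base
      show ?case by (simp add: S_def)
    next
      case (step y z)
      then show ?case using closed[of y z] closed[of z y] by (auto simp: hasse_edges_on_def)
    qed
  qed
  have "leftmost a" "leftmost b"
    unfolding leftmost_def using all rb unfolding V_def S_def by fastforce+
  then show False using leftmost nt by blast
qed

text \<open>By planarity a vertex of degree at least two among the upper neighbours of \<open>a\<close>
  is the first or the last of them, and the first one is fixed by induction.\<close>

lemma branching_vertices_fixed:
  assumes f: "order_automorphism f"
    and fix_left: "\<And>x. leftmost x \<Longrightarrow> f x = x"
    and ab: "covered_by a b"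
  shows "(\<forall>b'. b' \<noteq> b \<and> covered_by a b' \<longrightarrow> f a = a) \<and>
    (\<forall>a'. a' \<noteq> a \<and> covered_by a' b \<longrightarrow> f b = b)"
  using ab
proof (induction "place a + place b" arbitrary: a b rule: less_induct)
  case less
  note ab = less.prems
  have IHa: "f a' = a'" if "place a' + place b' < place a + place b"
    "covered_by a' b'" "covered_by a' b''" "b'' \<noteq> b'" for a' b' b''
    using less.hyps[OF that(1,2)] that by blast
  have IHb: "f b' = b'" if "place a' + place b' < place a + place b"
    "covered_by a' b'" "covered_by a'' b'" "a'' \<noteq> a'" for a' a'' b'
    using less.hyps[OF that(1,2)] that by blast
  have inj: "f x = f y \<longleftrightarrow> x = y" for x y
    using f by (auto simp: order_automorphism_def bij_def inj_eq)
  have cov: "covered_by (f x) (f y)" if "covered_by x y" for x y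
    using automorphism_covered_by[OF f] that by simp
  have same_rank: "poset_rank x = poset_rank x'" if "covered_by x y" "covered_by x' y" for x x' y :: 'a
    using rank_covered_by[OF that(1)] rank_covered_by[OF that(2)] by simp
  from ab show ?case
  proof (cases rule: earlier_adjacent_edge)
    case leftmost
    then show ?thesis using fix_left by blast
  next
    case (lower b')
    \<comment> \<open>The edge from \<open>a\<close> to \<open>b'\<close> has a smaller sum of
      places, and \<open>a\<close> branches there because of \<open>b\<close>.\<close>
    have fa: "f a = a" using IHa[of a b' b] lower ab by auto
    have "f b = b" if a': "a' \<noteq> a" "covered_by a' b" for a'
    proof (rule ccontr)
      assume ne: "f b \<noteq> b"
      have ra: "poset_rank a' = poset_rank a" using same_rank a'(2) ab by blast
      \<comment> \<open>A lower neighbour \<open>a'\<close> of \<open>b\<close> left of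
        \<open>a\<close> would make its edge cross the one from \<open>a\<close> to
        \<open>b'\<close>.\<close>
      have "\<not> place a' < place a" using place_noncrossing[OF a'(2) lower(1) ra] lower(2) by linarith
      then have aa': "place a < place a'" using place_inject[OF ra] a'(1) by linarith
      have afb: "covered_by a (f b)" using cov[OF ab] fa by simp
      \<comment> \<open>If \<open>f b\<close> were left of \<open>b\<close>, the induction
        hypothesis for the edge from \<open>a\<close> to \<open>f b\<close> would apply:
        \<open>f b\<close> also has the lower neighbour \<open>f a'\<close>. Then \<open>f b\<close>
        is fixed, and by injectivity so is \<open>b\<close>.\<close>
      have "f a' \<noteq> a" using inj[of a' a] fa a'(1) by simp
      then have "\<not> place (f b) < place b"
        using IHb[of a "f b" "f a'"] afb cov[OF a'(2)] ne inj by auto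
      \<comment> \<open>If \<open>f b\<close> were right of \<open>b\<close>, the edges from
        \<open>a\<close> to \<open>f b\<close> and from \<open>a'\<close> to \<open>b\<close> would
        cross.\<close>
      moreover have "place (f b) \<le> place b"
        using place_noncrossing[OF afb a'(2) ra[symmetric] aa'] .
      ultimately show False using place_inject[OF automorphism_rank[OF f]] ne by auto
    qed
    then show ?thesis using fa by blast
  next
    \<comment> \<open>The same argument with the two levels exchanged.\<close>
    case (upper a')
    have fb: "f b = b" using IHb[of a' b a] upper ab by auto
    have ra: "poset_rank a' = poset_rank a" using same_rank upper(1) ab by blast
    have "f a = a" if b': "b' \<noteq> b" "covered_by a b'" for b'
    proof (rule ccontr)
      assume ne: "f a \<noteq> a"
      have rb: "poset_rank b' = poset_rank b" using rank_covered_by b'(2) ab by metis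
      have "place b \<le> place b'" using place_noncrossing[OF upper(1) b'(2) ra upper(2)] .
      then have bb': "place b < place b'" using place_inject[OF rb] b'(1) by linarith
      have fab: "covered_by (f a) b" using cov[OF ab] fb by simp
      have "f b' \<noteq> b" using inj[of b' b] fb b'(1) by simp
      then have "\<not> place (f a) < place a"
        using IHa[of "f a" b "f b'"] fab cov[OF b'(2)] ne inj by auto
      moreover have "\<not> place a < place (f a)"
        using place_noncrossing[OF b'(2) fab automorphism_rank[OF f, symmetric]] bb' by linarith
      ultimately show False using place_inject[OF automorphism_rank[OF f]] ne by auto
    qed
    then show ?thesis using fb by blast
  qed
qed

text \<open>Each edge at \<open>x\<close> has both ends leftmost or an end with a further neighbour
  on the other level. The first case and branching at \<open>x\<close> would fix \<open>x\<close>,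
  so the other end branches and is fixed. Thus all neighbours of \<open>x\<close> are fixed, and
  \<open>x\<close> and \<open>f x\<close> have the same ones.\<close>

lemma moved_vertex_twin:
  assumes f: "order_automorphism f"
    and fix_left: "\<And>x. leftmost x \<Longrightarrow> f x = x"
    and ne: "f x \<noteq> x"
  shows "twins x (f x)"
proof -
  have fixed: "(\<forall>b'. b' \<noteq> b \<and> covered_by a b' \<longrightarrow> f a = a) \<and>
      (\<forall>a'. a' \<noteq> a \<and> covered_by a' b \<longrightarrow> f b = b)" if "covered_by a b" for a b
    by (rule branching_vertices_fixed[OF f fix_left that])
  note rank = automorphism_rank[OF f] and cov = automorphism_covered_by[OF f]
  have surj: "\<exists>y. f y = z" for z using f by (metis order_automorphism_def bij_pointE)
  have up: "f u = u" if "covered_by x u" for u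
    using that
  proof (cases rule: earlier_adjacent_edge)
    case leftmost
    then show ?thesis using fix_left ne by blast
  next
    case (lower b')
    then show ?thesis using fixed[OF that] ne by auto
  next
    case (upper a')
    then show ?thesis using fixed[OF that] by auto
  qed
  have down: "f u = u" if "covered_by u x" for u
    using that
  proof (cases rule: earlier_adjacent_edge)
    case leftmost
    then show ?thesis using fix_left ne by blast
  next
    case (lower b')
    then show ?thesis using fixed[OF that] by auto
  next
    case (upper a')
    then show ?thesis using fixed[OF that] ne by auto
  qed
  \<comment> \<open>For the converse, a cover of \<open>f x\<close> is the image of a cover of
    \<open>x\<close>, which is fixed.\<close>
  have ups: "covered_by x u \<longleftrightarrow> covered_by (f x) u" for u
    using up cov surj by metis
  have downs: "covered_by u x \<longleftrightarrow> covered_by u (f x)" for u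
    using down cov surj by metis
  \<comment> \<open>Every element above a vertex lies weakly above one of its upper covers.\<close>
  have "x < z \<longleftrightarrow> f x < z" for z
    by (meson ups covered_by_less exists_upper_cover order.strict_trans2)
  moreover have "z < x \<longleftrightarrow> z < f x" for z
    by (meson downs covered_by_less exists_lower_cover order.strict_trans1)
  ultimately show ?thesis
    unfolding twins_def using same_rank_incomparable[OF rank] same_rank_incomparable[OF rank[symmetric]] ne
    by metis
qed

text \<open>Automorphisms preserve ranks and each level has only one leftmost vertex, so preserving
  colors means fixing these vertices; any other moved vertex would have a twin.\<close>

lemma distinguishing_leftmost:
  assumes "twin_free TYPE('a)"
  shows "distinguishing (\<lambda>x. if leftmost x then 1 else 0 :: nat)"
    (is "distinguishing ?c")
  unfolding distinguishing_def
proof (intro allI impI)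
  fix f :: "'a \<Rightarrow> 'a" assume f: "order_automorphism f \<and> (\<forall>x. ?c (f x) = ?c x)"
  have "f x = x" if x: "leftmost x" for x
  proof -
    have rank: "poset_rank (f x) = poset_rank x" using automorphism_rank f by blast
    have "?c (f x) = 1" using x f by simp
    then have "leftmost (f x)" by (simp split: if_splits)
    then have "place (f x) = place x" using x rank by (simp add: leftmost_def order.antisym)
    then show ?thesis by (rule place_inject[OF rank])
  qed
  then have "f x = x" for x
    using moved_vertex_twin[of f x] f assms unfolding twin_free_def by blast
  then show "f = id" by auto
qed

end

theorem theorem5p6:
  assumes "twin_free TYPE('a::{finite,lattice})"
    and "rank_connected TYPE('a)"
    and "planar_poset TYPE('a)"
  shows "distinguishing_number TYPE('a) \<le> 2"
proof -
  have "ranked TYPE('a)" using assms(2) by (simp add: rank_connected_def)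
  then obtain bt tp :: 'a where "graded_poset bt tp" by (rule ranked_imp_graded)
  then interpret graded_poset bt tp .
  obtain pos :: "'a \<Rightarrow> real \<times> real" and \<gamma> where "planar_drawing pos \<gamma>"
    using assms(3) unfolding planar_poset_def by blast
  then interpret rank_connected_drawing bt tp pos \<gamma>
  proof unfold_locales
    fix a b :: 'a assume "covered_by a b"
    \<comment> \<open>The edge itself shows that both ranks occur, as \<open>rank_connected\<close>
      demands.\<close>
    then have "poset_rank b = Suc (poset_rank a)" by (rule rank_covered_by)
    then show "hasse_connected_on {x::'a. poset_rank x = poset_rank a \<or> poset_rank x = Suc (poset_rank a)}"
      using assms(2) unfolding rank_connected_def by blast
  qed
  define c :: "'a \<Rightarrow> nat"
    where "c = (\<lambda>x. if leftmost x then 1 else 0)"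
  have "distinguishing c" unfolding c_def using assms(1) by (rule distinguishing_leftmost)
  then have "distinguishing_number TYPE('a) \<le> card (range c)"
    unfolding distinguishing_number_def by (intro Least_le) blast
  \<comment> \<open>Only an inclusion: if every level is a single vertex, the color 0 does not
    occur.\<close>
  also have "range c \<subseteq> {0, 1}" by (auto simp: c_def)
  then have "card (range c) \<le> card {0, 1::nat}" by (intro card_mono) auto
  also have "\<dots> = 2" by simp
  finally show ?thesis .
qed

end
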